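(* There is no smooth function $u:\mathbb{R}^2\to\mathbb{R}$ satisfying all of the following: (i) $-\Delta u = x_1 e^{u}$ in $\mathbb{R}^2$, where $x=(x_1,x_2)$; (ii) $u(x)\le u(0)=0$ for all $x\in\mathbb{R}^2$; (iii) $\int_{\mathbb{R}^2}|x_1|e^{u(x)}\,dx<+\infty$; (iv) $A:=\int_{\mathbb{R}^2}x_1 e^{u(x)}\,dx>0$. *)

theory Defs
  imports "HOL-Analysis.Analysis"
begin

definition partial :: "2 \<Rightarrow> (real^2 \<Rightarrow> real) \<Rightarrow> real^2 \<Rightarrow> real" where
  "partial i f x = deriv (\<lambda>t. f (x + t *\<^sub>R axis i 1)) 0"

fun Ck :: "nat \<Rightarrow> (real^2 \<Rightarrow> real) \<Rightarrow> bool" where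
  "Ck 0 f = continuous_on UNIV f"
| "Ck (Suc k) f = ((\<forall>x. f differentiable (at x)) \<and> (\<forall>i. Ck k (partial i f)))"

definition smooth :: "(real^2 \<Rightarrow> real) \<Rightarrow> bool" where
  "smooth f \<longleftrightarrow> (\<forall>k. Ck k f)"

definition laplacian :: "(real^2 \<Rightarrow> real) \<Rightarrow> real^2 \<Rightarrow> real" where
  "laplacian f x = (\<Sum>i\<in>UNIV. partial i (partial i f) x)"

end

theory Submission
  imports Defs
begin

text \<open>
  Conditions (i) and (ii) are already contradictory. On the half plane \<open>x\<^sub>1 < 0\<close> the function
  \<open>u\<close> is strictly subharmonic, hence negative there, and it attains its maximum over the closed
  half plane at the boundary point \<open>0\<close>. Hopf's boundary point argument, with the strictly
  subharmonic barrier \<open>h = - x\<^sub>1 + 2 x\<^sub>1\<^sup>2 - x\<^sub>2\<^sup>2\<close>, gives \<open>u \<le> - \<epsilon> h\<close> near \<open>0\<close> and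
  therefore \<open>\<partial>\<^sub>1 u(0) \<ge> \<epsilon> > 0\<close>. But \<open>\<nabla>u(0) = 0\<close>, since \<open>0\<close> is a global maximum.
\<close>

text \<open>\<open>partial\<close> is a \<open>deriv\<close> at parameter 0, meaningful only where
  the derivative exists. Differentiability of \<open>f\<close> supplies it, and a shift along the
  line carries it from 0 to every \<open>t\<close>.\<close>

lemma has_field_derivative_partial:
  assumes "\<And>x. f differentiable (at x)"
  shows "((\<lambda>s. f (x + s *\<^sub>R axis i 1)) has_field_derivative partial i f (x + t *\<^sub>R axis i 1)) (at t)"
proof -
  have D: "(\<lambda>s. f (y + s *\<^sub>R axis i 1)) differentiable (at r)" for y r
  proof (rule differentiable_compose[where f = f and g = "\<lambda>s. y + s *\<^sub>R axis i 1"])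
    show "f differentiable at (y + r *\<^sub>R axis i 1)"
      by (rule assms)
    show "(\<lambda>s. y + s *\<^sub>R axis i 1) differentiable at r"
      by (intro derivative_intros)
  qed
  have "((\<lambda>s. f ((x + t *\<^sub>R axis i 1) + s *\<^sub>R axis i 1)) has_field_derivative
      partial i f (x + t *\<^sub>R axis i 1)) (at 0)"
    unfolding partial_def using D[of "x + t *\<^sub>R axis i 1" 0]
    by (metis DERIV_deriv_iff_real_differentiable)
  then have "((\<lambda>s. f (x + (t + s) *\<^sub>R axis i 1)) has_field_derivative
      partial i f (x + t *\<^sub>R axis i 1)) (at 0)"
    by (simp add: algebra_simps)
  then show ?thesis
    using DERIV_at_within_shift[of "\<lambda>s. f (x + s *\<^sub>R axis i 1)" _ t 0 UNIV] by simp
qed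

text \<open>If \<open>l > 0\<close>, then \<open>g'\<close>, which vanishes at the maximum, is
  positive just to the right of 0, and the mean value theorem makes \<open>g\<close> exceed
  \<open>g 0\<close> there.\<close>

lemma DERIV_second_local_max_le:
  fixes g :: "real \<Rightarrow> real"
  assumes g: "\<And>t. (g has_field_derivative g' t) (at t)"
    and g': "(g' has_field_derivative l) (at 0)"
    and d: "d > 0" and le: "\<And>t. \<bar>t\<bar> < d \<Longrightarrow> g t \<le> g 0"
  shows "l \<le> 0"
proof (rule ccontr)
  assume "\<not> l \<le> 0"
  have g0: "g' 0 = 0"
    using DERIV_local_max[OF g d] le by simp
  obtain e where e: "e > 0" "\<And>h. 0 < h \<Longrightarrow> h < e \<Longrightarrow> g' 0 < g' h"
    using DERIV_pos_inc_right[OF g'] \<open>\<not> l \<le> 0\<close> by auto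
  define s where "s = min d e / 2"
  have s: "0 < s" "s < d" "s < e"
    using d e by (auto simp: s_def)
  obtain z where z: "0 < z" "z < s" "g s - g 0 = (s - 0) * g' z"
    using MVT2[of 0 s g g'] g s by auto
  have "0 < g' z"
    using e(2)[of z] z s g0 by simp
  with z s have "g 0 < g s"
    by (smt (verit) mult_pos_pos)
  with le[of s] s show False
    by simp
qed

text \<open>The quadratic stands for a barrier restricted to a coordinate line: its linear part
  drops out of the second derivative, so \<open>a\<close> is arbitrary, and \<open>b\<close>
  contributes \<open>2 * b\<close>.\<close>

lemma partial_partial_le_of_quadratic_bound:
  assumes "Ck 2 u" "d > 0"
    and le: "\<And>t. \<bar>t\<bar> < d \<Longrightarrow> u (x + t *\<^sub>R axis i 1) + (a * t + b * t\<^sup>2) \<le> u x"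
  shows "partial i (partial i u) x + 2 * b \<le> 0"
proof -
  have u: "\<And>x. u differentiable (at x)" "\<And>x. partial i u differentiable (at x)"
    using \<open>Ck 2 u\<close> by (auto simp: numeral_2_eq_2)
  show ?thesis
  proof (rule DERIV_second_local_max_le)
    show "((\<lambda>t. u (x + t *\<^sub>R axis i 1) + (a * t + b * t\<^sup>2)) has_field_derivative
        partial i u (x + t *\<^sub>R axis i 1) + (a + 2 * b * t)) (at t)" for t
      by (rule derivative_eq_intros has_field_derivative_partial u refl | simp)+
    have "((\<lambda>t. partial i u (x + t *\<^sub>R axis i 1)) has_field_derivative partial i (partial i u) x) (at 0)"
      using has_field_derivative_partial[OF u(2), of x i 0] by simp
    then show "((\<lambda>t. partial i u (x + t *\<^sub>R axis i 1) + (a + 2 * b * t)) has_field_derivative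
        partial i (partial i u) x + 2 * b) (at 0)"
      by (auto intro!: derivative_eq_intros)
  qed (use assms in auto)
qed

theorem theorem1:
  "\<not> (\<exists>u :: real^2 \<Rightarrow> real.
        smooth u \<and>
        (\<forall>x. - laplacian u x = x $ 1 * exp (u x)) \<and>
        (\<forall>x. u x \<le> u 0) \<and> u 0 = 0 \<and>
        integrable lborel (\<lambda>x. \<bar>x $ 1\<bar> * exp (u x)) \<and>
        (\<integral>x. x $ 1 * exp (u x) \<partial>lborel) > 0)"
proof
  assume "\<exists>u :: real^2 \<Rightarrow> real.
        smooth u \<and>
        (\<forall>x. - laplacian u x = x $ 1 * exp (u x)) \<and>
        (\<forall>x. u x \<le> u 0) \<and> u 0 = 0 \<and>
        integrable lborel (\<lambda>x. \<bar>x $ 1\<bar> * exp (u x)) \<and>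
        (\<integral>x. x $ 1 * exp (u x) \<partial>lborel) > 0"
  then obtain u :: "real^2 \<Rightarrow> real" where "smooth u"
    and pde: "\<And>x. - laplacian u x = x $ 1 * exp (u x)"
    and max: "\<And>x. u x \<le> 0" and u0: "u 0 = 0"
    by metis
  have C2: "Ck 2 u"
    using \<open>smooth u\<close> by (simp add: smooth_def)
  have diff: "\<And>x. u differentiable (at x)"
    using C2 by (simp add: numeral_2_eq_2)
  have cont: "continuous_on S u" for S
    using \<open>smooth u\<close> continuous_on_subset[of UNIV u S] by (metis smooth_def Ck.simps(1) subset_UNIV)
  have lap: "laplacian u x = partial 1 (partial 1 u) x + partial 2 (partial 2 u) x" for x
    by (simp add: laplacian_def sum_2)
  have lap_pos: "laplacian u x > 0" if "x $ 1 < 0" for x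
    using pde[of x] that by (smt (verit) exp_gt_zero mult_neg_pos)

  \<comment> \<open>A zero of \<open>u\<close> would be a global maximum, where both pure second
    partials are at most 0, against \<open>lap_pos\<close>.\<close>
  have neg: "u x < 0" if "x $ 1 < 0" for x
  proof (rule ccontr)
    assume "\<not> u x < 0"
    then have "u y \<le> u x" for y
      using max[of y] by linarith
    then have "partial i (partial i u) x + 2 * 0 \<le> 0" for i
      by (intro partial_partial_le_of_quadratic_bound[OF C2, of 1 x i 0 0]) auto
    then show False
      using lap_pos[OF that] lap[of x] by (smt (verit))
  qed

  \<comment> \<open>The Laplacian of \<open>h\<close> is 4 - 2 = 2, and at the origin
    \<open>h\<close> vanishes with slope -1 in the first coordinate. For first coordinate in
    [-1/4, 0], \<open>h\<close> is at most 3/8 minus the square of the second, hence negative where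
    the second is 1 or -1; on the axis \<open>x $ 1 = 0\<close> it is at most 0.\<close>
  define h :: "real^2 \<Rightarrow> real" where "h = (\<lambda>x. - x $ 1 + 2 * (x $ 1)\<^sup>2 - (x $ 2)\<^sup>2)"
  have conth: "continuous_on S h" for S
    unfolding h_def by (intro continuous_intros)
  have h1: "h (x + t *\<^sub>R axis 1 1) = h x + ((4 * x $ 1 - 1) * t + 2 * t\<^sup>2)" for x t
    by (simp add: h_def axis_def power2_eq_square algebra_simps)
  have h2: "h (x + t *\<^sub>R axis 2 1) = h x + (- 2 * x $ 2 * t + - 1 * t\<^sup>2)" for x t
    by (simp add: h_def axis_def power2_eq_square algebra_simps)

  \<comment> \<open>The left edge of the rectangle \<open>R\<close> below, written as a degenerate
    box so that it is compact and \<open>u\<close> attains a maximum on it, negative by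
    \<open>neg\<close>.\<close>
  define side :: "(real^2) set" where "side = cbox (vector [-1/4, -1]) (vector [-1/4, 1])"
  have side: "x \<in> side \<longleftrightarrow> x $ 1 = -1/4 \<and> -1 \<le> x $ 2 \<and> x $ 2 \<le> 1" for x
    by (auto simp: side_def mem_box_cart forall_2)
  have "vector [-1/4, 0] \<in> side"
    by (simp add: side)
  then obtain y where y: "y \<in> side" "\<And>x. x \<in> side \<Longrightarrow> u x \<le> u y"
    using continuous_attains_sup[of side u] cont by (auto simp: side_def)
  define \<epsilon> where "\<epsilon> = - u y"
  have \<epsilon>: "\<epsilon> > 0"
    using neg[of y] y(1) by (simp add: \<epsilon>_def side)

  define R :: "(real^2) set" where "R = cbox (vector [-1/4, -1]) (vector [0, 1])"
  have R: "x \<in> R \<longleftrightarrow> -1/4 \<le> x $ 1 \<and> x $ 1 \<le> 0 \<and> -1 \<le> x $ 2 \<and> x $ 2 \<le> 1" for x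
    by (auto simp: R_def mem_box_cart forall_2)
  \<comment> \<open>A positive maximum over \<open>R\<close> is shown to lie in the interior, where
    the second-derivative test applies.\<close>
  have barrier: "u x + \<epsilon> * h x \<le> 0" if "x \<in> R" for x
  proof (rule ccontr)
    assume *: "\<not> u x + \<epsilon> * h x \<le> 0"
    have "0 \<in> R"
      by (simp add: R)
    then have "R \<noteq> {}"
      by blast
    moreover have "compact R"
      by (simp add: R_def)
    moreover have "continuous_on R (\<lambda>x. u x + \<epsilon> * h x)"
      by (intro continuous_intros cont conth)
    ultimately obtain z where z: "z \<in> R"
      and zmax: "\<And>w. w \<in> R \<Longrightarrow> u w + \<epsilon> * h w \<le> u z + \<epsilon> * h z"
      using continuous_attains_sup[of R "\<lambda>x. u x + \<epsilon> * h x"] by blast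
    have zpos: "u z + \<epsilon> * h z > 0"
      using zmax[OF that] * by simp
    \<comment> \<open>Since \<open>u z\<close> is at most 0, positivity must come from
      \<open>h\<close>; this excludes the top, bottom and right edges.\<close>
    have hpos: "h z > 0"
    proof -
      have "0 < \<epsilon> * h z"
        using zpos max[of z] by linarith
      then show ?thesis
        using \<epsilon> by (simp add: zero_less_mult_iff)
    qed
    have bds: "-1/4 \<le> z $ 1" "z $ 1 \<le> 0" "-1 \<le> z $ 2" "z $ 2 \<le> 1"
      using z by (auto simp: R)
    have sq: "(z $ 1)\<^sup>2 \<le> 1/16"
      using bds abs_le_square_iff[of "z $ 1" "1/4"] by (simp add: power2_eq_square)
    have "(z $ 2)\<^sup>2 < 1" and hle: "h z \<le> 1"
      using hpos bds sq zero_le_power2[of "z $ 2"] unfolding h_def by linarith+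
    then have z2: "-1 < z $ 2" "z $ 2 < 1"
      using abs_square_less_1[of "z $ 2"] by auto
    have z1: "z $ 1 < 0"
    proof -
      have "z $ 1 \<noteq> 0"
        using hpos unfolding h_def by auto
      then show ?thesis
        using bds by simp
    qed
    \<comment> \<open>On the left edge \<open>u\<close> is at most -\<epsilon> and \<open>h\<close>
      at most 1, so the sum cannot be positive.\<close>
    have "z $ 1 \<noteq> -1/4"
    proof
      assume "z $ 1 = -1/4"
      then have "u z \<le> - \<epsilon>"
        using y(2)[of z] bds by (simp add: side \<epsilon>_def)
      moreover have "\<epsilon> * h z \<le> \<epsilon> * 1"
        using hle \<epsilon> by (intro mult_left_mono) auto
      ultimately show False
        using zpos by simp
    qed
    then have "z \<in> box (vector [-1/4, -1]) (vector [0, 1])"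
      using bds z1 z2 by (simp add: mem_box_cart forall_2)
    then obtain d where d: "d > 0" "ball z d \<subseteq> R"
      unfolding R_def by (rule openE[OF open_box]) (use box_subset_cbox in blast)
    have le: "u (z + t *\<^sub>R axis i 1) + \<epsilon> * h (z + t *\<^sub>R axis i 1) \<le> u z + \<epsilon> * h z"
      if "\<bar>t\<bar> < d" for t i
    proof (rule zmax)
      show "z + t *\<^sub>R axis i 1 \<in> R"
        using that by (intro subsetD[OF d(2)]) (simp add: dist_norm)
    qed
    \<comment> \<open>Adding the bounds for the two directions gives
      \<open>laplacian u z + 2 * \<epsilon> \<le> 0\<close>, although \<open>laplacian u z\<close>
      is positive.\<close>
    have "partial 1 (partial 1 u) z + 2 * (2 * \<epsilon>) \<le> 0"
      using d(1) le[of _ 1] unfolding h1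
      by (intro partial_partial_le_of_quadratic_bound[OF C2, of d z 1 "\<epsilon> * (4 * z $ 1 - 1)"])
        (auto simp: algebra_simps)
    moreover have "partial 2 (partial 2 u) z + 2 * (- \<epsilon>) \<le> 0"
      using d(1) le[of _ 2] unfolding h2
      by (intro partial_partial_le_of_quadratic_bound[OF C2, of d z 2 "\<epsilon> * (- 2 * z $ 2)"])
        (auto simp: algebra_simps)
    ultimately show False
      using lap[of z] lap_pos[OF z1] \<epsilon> by linarith
  qed

  define g where "g t = u (t *\<^sub>R axis 1 1)" for t
  have g': "(g has_field_derivative partial 1 u 0) (at 0)"
    using has_field_derivative_partial[OF diff, of 0 1 0] by (simp add: g_def[abs_def])
  have crit: "partial 1 u 0 = 0"
    by (rule DERIV_local_max[OF g', of 1]) (use max u0 in \<open>auto simp: g_def\<close>)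
  \<comment> \<open>The negative slope forces \<open>g (- s) + \<epsilon> * s > 0\<close> for small
    positive \<open>s\<close>, whereas the barrier bounds the same quantity by
    \<open>- 2 * \<epsilon> * s\<^sup>2\<close>.\<close>
  have "((\<lambda>t. g t - \<epsilon> * t) has_field_derivative - \<epsilon>) (at 0)"
    using g' unfolding crit by (auto intro!: derivative_eq_intros)
  then obtain d where d: "d > 0" "\<And>s. 0 < s \<Longrightarrow> s < d \<Longrightarrow> g 0 < g (- s) + \<epsilon> * s"
    using DERIV_neg_dec_left[of "\<lambda>t. g t - \<epsilon> * t" "- \<epsilon>" 0] \<epsilon> by auto
  define s where "s = min d (1/4) / 2"
  have s: "0 < s" "s < d" "s < 1/4"
    using d(1) by (auto simp: s_def)
  have "h ((- s) *\<^sub>R axis 1 1) = s + 2 * s\<^sup>2"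
    by (simp add: h_def axis_def)
  moreover have "(- s) *\<^sub>R axis 1 1 \<in> R"
    using s by (simp add: R axis_def)
  ultimately have "g (- s) + \<epsilon> * (s + 2 * s\<^sup>2) \<le> 0"
    using barrier[of "(- s) *\<^sub>R axis 1 1"] unfolding g_def by metis
  moreover have "\<epsilon> * (2 * s\<^sup>2) \<ge> 0"
    using \<epsilon> by simp
  ultimately show False
    using d(2)[OF s(1,2)] u0 by (simp add: g_def algebra_simps)
qed

end
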